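(* Let $X$ be a complex Banach space with dual space $X^{*}$. The following assertions are equivalent: (1) $X^{*}$ is Fréchet differentiable. (2) For all sequences $(x_n)_{n\ge 0}$, $(y_n)_{n\ge 0}$ in $S_X$ and all $a^{*}\in S_{X^{*}}$ such that $\langle x_n,a^{*}\rangle\to 1$ and $\langle y_n,a^{*}\rangle\to 1$ as $n\to+\infty$, one has $\|x_n-y_n\|_X\to 0$ as $n\to+\infty$. (3) $X^{*}$ is uniformly smooth.
   Context: For a Banach space $Y$, $B_Y$ denotes its closed unit ball, $S_Y$ its unit sphere, and $\langle y,y^{*}\rangle$ the duality pairing between $y\in Y$ and $y^{*}\in Y^{*}$. A Banach space $(Y,\|\cdot\|)$ is said to be Fréchet differentiable if for every $a\in Y$, $a\neq 0$, one has $$\lim_{\|h\|\to 0}\frac{\|a+h\|+\|a-h\|-2\|a\|}{\|h\|}=0.$$ Terminology of the paper (not the usual modulus-of-smoothness notion): a Banach space $Y$ is said to be uniformly smooth if for every $y\in S_Y$ there is a unique point $y^{*}\in S_{Y^{*}}$ with the following property: for every $\varepsilon>0$ there exists $\delta>0$ such that if $g\in B_{Y^{*}}$ satisfies $\langle y,g\rangle>1-\delta$, then $\|y^{*}-g\|<\varepsilon$. When the scalars are complex, the inequality $\langle y,g\rangle>1-\delta$ means that $\langle y,g\rangle$ is a real number and is greater than $1-\delta$. Here both definitions are applied with $Y=X^{*}$, so that $Y^{*}=X^{**}$. *)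

theory Defs
  imports "HOL-Analysis.Analysis"
begin

section \<open>Complex Banach spaces\<close>

text \<open>The distribution has no class of complex normed spaces. As usual, a complex normed space
  is a real normed space whose real scalar multiplication is the restriction of a complex one.\<close>

class complex_normed_vector = real_normed_vector +
  fixes scaleC :: "complex \<Rightarrow> 'a \<Rightarrow> 'a"  (infixr \<open>*\<^sub>C\<close> 75)
  assumes scaleC_add_right: "c *\<^sub>C (x + y) = c *\<^sub>C x + c *\<^sub>C y"
    and scaleC_add_left: "(c + d) *\<^sub>C x = c *\<^sub>C x + d *\<^sub>C x"
    and scaleC_scaleC: "c *\<^sub>C (d *\<^sub>C x) = (c * d) *\<^sub>C x"
    and scaleC_one: "1 *\<^sub>C x = x"
    and scaleR_scaleC: "r *\<^sub>R x = complex_of_real r *\<^sub>C x"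
    and norm_scaleC: "norm (c *\<^sub>C x) = cmod c * norm x"

class complex_banach = complex_normed_vector + banach

instantiation complex :: complex_banach
begin

definition scaleC_complex :: "complex \<Rightarrow> complex \<Rightarrow> complex"
  where "scaleC_complex c x = c * x"

instance
  by standard (auto simp: scaleC_complex_def algebra_simps norm_mult scaleR_conv_of_real)

end

section \<open>The dual space\<close>

typedef (overloaded) ('a::complex_normed_vector) cdual =
  "{f :: 'a \<Rightarrow>\<^sub>L complex. \<forall>c x. blinfun_apply f (c *\<^sub>C x) = c * blinfun_apply f x}"
  morphisms blinfun_of_cdual Abs_cdual
  by (rule exI[of _ 0]) simp

setup_lifting type_definition_cdual

lift_definition pairing :: "'a::complex_normed_vector \<Rightarrow> 'a cdual \<Rightarrow> complex"
    (\<open>(\<open>notation=\<open>mixfix pairing\<close>\<close>\<langle>_,/ _\<rangle>)\<close>)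
  is "\<lambda>x f. blinfun_apply f x" .

instantiation cdual :: (complex_normed_vector) real_normed_vector
begin

lift_definition zero_cdual :: "'a cdual" is 0
  by simp

lift_definition plus_cdual :: "'a cdual \<Rightarrow> 'a cdual \<Rightarrow> 'a cdual" is "(+)"
  by (simp add: plus_blinfun.rep_eq distrib_left)

lift_definition minus_cdual :: "'a cdual \<Rightarrow> 'a cdual \<Rightarrow> 'a cdual" is "(-)"
  by (simp add: minus_blinfun.rep_eq right_diff_distrib)

lift_definition uminus_cdual :: "'a cdual \<Rightarrow> 'a cdual" is uminus
  by (simp add: uminus_blinfun.rep_eq)

lift_definition scaleR_cdual :: "real \<Rightarrow> 'a cdual \<Rightarrow> 'a cdual" is "(*\<^sub>R)"
  by (simp add: scaleR_blinfun.rep_eq)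

lift_definition norm_cdual :: "'a cdual \<Rightarrow> real" is norm .

definition dist_cdual :: "'a cdual \<Rightarrow> 'a cdual \<Rightarrow> real"
  where "dist_cdual f g = norm (f - g)"

definition sgn_cdual :: "'a cdual \<Rightarrow> 'a cdual"
  where "sgn_cdual f = inverse (norm f) *\<^sub>R f"

definition [code del]:
  "(uniformity :: ('a cdual \<times> 'a cdual) filter) = (INF e\<in>{0 <..}. principal {(f, g). dist f g < e})"

definition open_cdual :: "'a cdual set \<Rightarrow> bool"
  where [code del]: "open_cdual S \<longleftrightarrow> (\<forall>f\<in>S. \<forall>\<^sub>F (f', g) in uniformity. f' = f \<longrightarrow> g \<in> S)"

instance
proof
  fix f g h :: "'a cdual" and a b :: real
  show "f + g + h = f + (g + h)" "f + g = g + f" "0 + f = f" "- f + f = 0" "f - g = f + - g"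
    by (transfer; simp)+
  show "a *\<^sub>R (f + g) = a *\<^sub>R f + a *\<^sub>R g" "(a + b) *\<^sub>R f = a *\<^sub>R f + b *\<^sub>R f"
    "a *\<^sub>R b *\<^sub>R f = (a * b) *\<^sub>R f" "1 *\<^sub>R f = f"
    by (transfer; simp add: scaleR_add_right scaleR_add_left)+
  show "dist f g = norm (f - g)" "sgn f = inverse (norm f) *\<^sub>R f"
    by (simp_all add: dist_cdual_def sgn_cdual_def)
  show "(norm f = 0) = (f = 0)" "norm (a *\<^sub>R f) = \<bar>a\<bar> * norm f"
    by (transfer; simp)+
  show "norm (f + g) \<le> norm f + norm g"
    by transfer (rule norm_triangle_ineq)
qed (simp_all add: uniformity_cdual_def open_cdual_def)

end

lemma norm_blinfun_mult_right:
  fixes f :: "'b::real_normed_vector \<Rightarrow>\<^sub>L complex"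
  shows "norm (blinfun_mult_right c o\<^sub>L f) = cmod c * norm f"
proof (cases "c = 0")
  case True
  then have "blinfun_mult_right c o\<^sub>L f = 0"
    by (intro blinfun_eqI) simp
  then show ?thesis using True by simp
next
  case False
  have le: "norm (blinfun_mult_right d o\<^sub>L g) \<le> cmod d * norm g"
    for d and g :: "'b \<Rightarrow>\<^sub>L complex"
    by (rule norm_blinfun_bound)
       (auto simp: norm_mult mult.assoc intro!: mult_left_mono norm_blinfun)
  have "blinfun_mult_right (inverse c) o\<^sub>L (blinfun_mult_right c o\<^sub>L f) = f"
    using False by (intro blinfun_eqI) simp
  then have "norm f \<le> inverse (cmod c) * norm (blinfun_mult_right c o\<^sub>L f)"
    using le[of "inverse c" "blinfun_mult_right c o\<^sub>L f"] by (simp add: norm_inverse del: inverse_eq_divide)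
  then have "cmod c * norm f \<le> norm (blinfun_mult_right c o\<^sub>L f)"
    using False by (simp add: divide_simps mult.commute)
  with le[of c f] show ?thesis by simp
qed

instantiation cdual :: (complex_normed_vector) complex_normed_vector
begin

lift_definition scaleC_cdual :: "complex \<Rightarrow> 'a cdual \<Rightarrow> 'a cdual"
  is "\<lambda>c f. blinfun_mult_right c o\<^sub>L f"
  by simp

instance
proof
  fix f g :: "'a cdual" and a :: real and c d :: complex
  show "c *\<^sub>C (f + g) = c *\<^sub>C f + c *\<^sub>C g" "(c + d) *\<^sub>C f = c *\<^sub>C f + d *\<^sub>C f"
    "c *\<^sub>C (d *\<^sub>C f) = (c * d) *\<^sub>C f" "1 *\<^sub>C f = f" "a *\<^sub>R f = complex_of_real a *\<^sub>C f"
    by (transfer; auto intro!: blinfun_eqI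
        simp: plus_blinfun.rep_eq scaleR_blinfun.rep_eq algebra_simps scaleR_conv_of_real)+
  show "norm (c *\<^sub>C f) = cmod c * norm f"
    by transfer (rule norm_blinfun_mult_right)
qed

end

lemma norm_cdual_eq: "norm f = onorm (\<lambda>x. \<langle>x, f\<rangle>)"
  by transfer (simp add: norm_blinfun.rep_eq)

instance cdual :: (complex_normed_vector) complex_banach
proof
  fix F :: "nat \<Rightarrow> 'a cdual"
  assume "Cauchy F"
  moreover have dist_eq: "dist (blinfun_of_cdual f) (blinfun_of_cdual g) = dist f g"
    for f g :: "'a cdual"
    by (simp add: dist_norm norm_cdual.rep_eq minus_cdual.rep_eq)
  ultimately have "Cauchy (\<lambda>n. blinfun_of_cdual (F n))"
    by (simp add: Cauchy_def)
  then obtain l where l: "(\<lambda>n. blinfun_of_cdual (F n)) \<longlonglongrightarrow> l"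
    using Cauchy_convergent_iff convergent_def by blast
  have pt: "(\<lambda>n. blinfun_apply (blinfun_of_cdual (F n)) x) \<longlonglongrightarrow> blinfun_apply l x" for x
    using l by (intro tendsto_intros)
  have "blinfun_apply l (c *\<^sub>C x) = c * blinfun_apply l x" for c x
  proof (rule LIMSEQ_unique[OF pt])
    have "blinfun_apply (blinfun_of_cdual (F n)) (c *\<^sub>C x)
        = c * blinfun_apply (blinfun_of_cdual (F n)) x" for n
      using blinfun_of_cdual[of "F n"] by simp
    then show "(\<lambda>n. blinfun_apply (blinfun_of_cdual (F n)) (c *\<^sub>C x)) \<longlonglongrightarrow> c * blinfun_apply l x"
      using tendsto_mult_left[OF pt, of c x] by simp
  qed
  then have "blinfun_of_cdual (Abs_cdual l) = l"
    by (simp add: Abs_cdual_inverse)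
  then have "F \<longlonglongrightarrow> Abs_cdual l"
    using l by (simp add: tendsto_iff flip: dist_eq)
  then show "convergent F"
    by (rule convergentI)
qed

section \<open>Smoothness properties of a Banach space\<close>

definition frechet_differentiable_space :: "'a::banach itself \<Rightarrow> bool"
  where "frechet_differentiable_space Y \<longleftrightarrow>
    (\<forall>a::'a. a \<noteq> 0 \<longrightarrow>
      ((\<lambda>h. (norm (a + h) + norm (a - h) - 2 * norm a) / norm h) \<longlongrightarrow> 0) (at 0))"

text \<open>This is not the usual notion of uniform smoothness through the modulus of smoothness:
  below, \<open>\<delta>\<close> may depend on \<open>y\<close>. The premises on \<open>\<langle>y, g\<rangle>\<close> say that it is a real number
  exceeding \<open>1 - \<delta>\<close>.\<close>

definition uniformly_smooth_space :: "'a::complex_banach itself \<Rightarrow> bool"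
  where "uniformly_smooth_space Y \<longleftrightarrow>
    (\<forall>y::'a. y \<in> sphere 0 1 \<longrightarrow>
      (\<exists>!y'::'a cdual. y' \<in> sphere 0 1 \<and>
        (\<forall>\<epsilon>>0. \<exists>\<delta>>0. \<forall>g\<in>cball 0 1.
          \<langle>y, g\<rangle> \<in> \<real> \<and> Re \<langle>y, g\<rangle> > 1 - \<delta> \<longrightarrow> norm (y' - g) < \<epsilon>)))"

end

theory Submission
  imports Defs
begin

text \<open>
  The key observation is Smulian's: the second difference \<open>\<parallel>a + h\<parallel> + \<parallel>a - h\<parallel> - 2 \<parallel>a\<parallel>\<close> measures
  how far apart functionals that almost norm \<open>a\<close> can be. If \<open>f\<close> and \<open>g\<close> lie in the dual
  unit ball and \<open>Re \<langle>a, f\<rangle>\<close> and \<open>Re \<langle>a, g\<rangle>\<close> are close to \<open>\<parallel>a\<parallel>\<close>, then \<open>Re \<langle>h, f - g\<rangle>\<close> exceeds the second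
  difference by at most a little, and taking \<open>h\<close> of fixed small norm bounds \<open>\<parallel>f - g\<parallel>\<close>
  (\<open>frechet_differentiable_slice\<close>). Conversely, if \<open>f\<close> almost norms \<open>a + h\<close> and \<open>g\<close> almost norms \<open>a - h\<close>,
  then both almost norm \<open>a\<close>, and the second difference is at most \<open>Re \<langle>h, f - g\<rangle>\<close> up to a small
  error. Thus Frechet differentiability says that the slices which \<open>a\<close> cuts off the dual ball
  shrink to a point.

  The three assertions about the dual of \<open>X\<close> are proved equivalent cyclically. Frechet
  differentiability of any space \<open>Y\<close> makes the slices of the ball of its dual shrink, and by the
  Hahn-Banach theorem each of these slices contains a functional that norms the given point; this is
  uniform smoothness. For \<open>Y\<close> the dual of \<open>X\<close>, the slices of the ball of the bidual contain, via the
  isometric embedding of \<open>X\<close>, those of the ball of \<open>X\<close>, so two norming sequences in \<open>X\<close> are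
  eventually close. Finally, the norm of a functional on \<open>X\<close> is approximated by values at unit
  vectors of \<open>X\<close>, so the converse half of Smulian's argument can be run with sequences in \<open>X\<close>
  alone, and the sequential condition gives Frechet differentiability.

  The Hahn-Banach theorem is obtained in the form "every sublinear functional dominates a linear
  one, with equality at a prescribed point" by showing that minimal sublinear functionals are
  linear.
\<close>

section \<open>The Hahn-Banach theorem\<close>

text \<open>Only one inequality is required for positive homogeneity: applying it to the scalar \<open>1 / t\<close>
  gives the other.\<close>

definition sublinear :: "('a::real_vector \<Rightarrow> real) \<Rightarrow> bool"
  where "sublinear p \<longleftrightarrow>
    (\<forall>x y. p (x + y) \<le> p x + p y) \<and> (\<forall>t>0. \<forall>x. p (t *\<^sub>R x) \<le> t * p x)"

lemma sublinear_add: "sublinear p \<Longrightarrow> p (x + y) \<le> p x + p y"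
  by (simp add: sublinear_def)

lemma sublinear_scaleR:
  assumes "sublinear p" "t \<ge> 0"
  shows "p (t *\<^sub>R x) = t * p x"
proof -
  have le: "p (s *\<^sub>R y) \<le> s * p y" if "s > 0" for s y
    using assms that by (auto simp: sublinear_def)
  show ?thesis
  proof (cases "t = 0")
    case True
    have "p 0 \<le> 2 * p 0" "p 0 \<le> 1 / 2 * p 0"
      using le[of 2 0] le[of "1 / 2" 0] by simp_all
    then have "p 0 = 0" by linarith
    with True show ?thesis by simp
  next
    case False
    then have t: "t > 0" using assms by simp
    have "p x \<le> 1 / t * p (t *\<^sub>R x)"
      using le[of "1 / t" "t *\<^sub>R x"] t by simp
    then have "t * p x \<le> p (t *\<^sub>R x)"
      using t by (simp add: field_simps)
    with le[OF t, of x] show ?thesis by simp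
  qed
qed

lemma sublinear_0: "sublinear p \<Longrightarrow> p 0 = 0"
  using sublinear_scaleR[of p 0 0] by simp

lemma sublinear_minus_ge: "sublinear p \<Longrightarrow> - p (- x) \<le> p x"
  using sublinear_add[of p x "- x"] sublinear_0[of p] by simp

text \<open>The hypotheses are what survives of sublinearity when the two summands on the right are
  evaluated by different members of the family. Both families used below, chains and the
  directional modifications of one functional, satisfy them.\<close>

lemma sublinear_INF:
  assumes ne: "F \<noteq> {}"
    and bdd: "\<And>x. bdd_below ((\<lambda>f. f x) ` F)"
    and add: "\<And>f g. f \<in> F \<Longrightarrow> g \<in> F \<Longrightarrow> \<exists>h\<in>F. \<forall>x y. h (x + y) \<le> f x + g y"
    and scale: "\<And>f t. f \<in> F \<Longrightarrow> t > 0 \<Longrightarrow> \<exists>h\<in>F. \<forall>x. h (t *\<^sub>R x) \<le> t * f x"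
  shows "sublinear (\<lambda>x. INF f\<in>F. f x :: real)"
proof -
  have lower: "(INF f\<in>F. f x) \<le> h x" if "h \<in> F" for h x
    by (rule cINF_lower[OF bdd that])
  show ?thesis
    unfolding sublinear_def
  proof (intro conjI allI impI)
    fix x y
    have "(INF f\<in>F. f (x + y)) - g y \<le> f x" if fg: "f \<in> F" "g \<in> F" for f g
    proof -
      obtain h where "h \<in> F" "h (x + y) \<le> f x + g y"
        using add[OF fg] by blast
      with lower[of h "x + y"] show ?thesis by linarith
    qed
    then have "(INF f\<in>F. f (x + y)) - g y \<le> (INF f\<in>F. f x)" if "g \<in> F" for g
      using ne that by (intro cINF_greatest) auto
    then have "(INF f\<in>F. f (x + y)) - (INF f\<in>F. f x) \<le> g y" if "g \<in> F" for g
      using that by fastforce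
    then have "(INF f\<in>F. f (x + y)) - (INF f\<in>F. f x) \<le> (INF f\<in>F. f y)"
      using ne by (intro cINF_greatest) auto
    then show "(INF f\<in>F. f (x + y)) \<le> (INF f\<in>F. f x) + (INF f\<in>F. f y)"
      by linarith
  next
    fix t :: real and x assume t: "t > 0"
    have "(INF f\<in>F. f (t *\<^sub>R x)) / t \<le> f x" if f: "f \<in> F" for f
    proof -
      obtain h where "h \<in> F" "h (t *\<^sub>R x) \<le> t * f x"
        using scale[OF f t] by blast
      with lower[of h "t *\<^sub>R x"] have "(INF f\<in>F. f (t *\<^sub>R x)) \<le> t * f x" by linarith
      with t show ?thesis by (simp add: field_simps)
    qed
    then have "(INF f\<in>F. f (t *\<^sub>R x)) / t \<le> (INF f\<in>F. f x)"
      using ne by (intro cINF_greatest) auto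
    then show "(INF f\<in>F. f (t *\<^sub>R x)) \<le> t * (INF f\<in>F. f x)"
      using t by (simp add: field_simps)
  qed
qed

text \<open>A sublinear functional can be lowered until it is odd in a given direction \<open>z\<close>: the infimum
  of \<open>p (x + t z) - t p z\<close> over \<open>t \<ge> 0\<close> is again sublinear, \<open>t = 0\<close> shows that it is below \<open>p\<close>,
  and \<open>t = 1\<close> gives the bound at \<open>- z\<close>.\<close>

lemma sublinear_lower_in_direction:
  assumes p: "sublinear p"
  shows "\<exists>q. sublinear q \<and> q \<le> p \<and> q (- z) \<le> - p z"
proof -
  define f where "f t x = p (x + t *\<^sub>R z) - t * p z" for t x
  define q where "q x = (INF g\<in>f ` {0..}. g x)" for x
  have "- p (- x) \<le> f t x" if "t \<ge> 0" for t x
    using sublinear_add[OF p, of "x + t *\<^sub>R z" "- x"] sublinear_scaleR[OF p that, of z]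
    by (simp add: f_def)
  then have bdd: "bdd_below ((\<lambda>g. g x) ` f ` {0..})" for x
    by (intro bdd_belowI[of _ "- p (- x)"]) auto
  have lower: "q x \<le> f t x" if "t \<ge> 0" for t x
    unfolding q_def using that by (intro cINF_lower[OF bdd]) auto
  have "sublinear q"
    unfolding q_def
  proof (rule sublinear_INF)
    fix g h assume "g \<in> f ` {0..}" "h \<in> f ` {0..}"
    then obtain s t where st: "s \<ge> 0" "t \<ge> 0" "g = f s" "h = f t" by auto
    have "f (s + t) (x + y) \<le> f s x + f t y" for x y
      using sublinear_add[OF p, of "x + s *\<^sub>R z" "y + t *\<^sub>R z"]
      by (simp add: f_def algebra_simps)
    with st show "\<exists>k\<in>f ` {0..}. \<forall>x y. k (x + y) \<le> g x + h y"
      by (intro bexI[of _ "f (s + t)"]) auto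
  next
    fix g and t :: real assume "g \<in> f ` {0..}" and t: "t > 0"
    then obtain s where s: "s \<ge> 0" "g = f s" by auto
    have "f (t * s) (t *\<^sub>R x) = t * f s x" for x
      using sublinear_scaleR[OF p, of t "x + s *\<^sub>R z"] t
      by (simp add: f_def algebra_simps)
    with s t show "\<exists>k\<in>f ` {0..}. \<forall>x. k (t *\<^sub>R x) \<le> t * g x"
      by (intro bexI[of _ "f (t * s)"]) auto
  qed (use bdd in auto)
  moreover have "q x \<le> p x" for x
    using lower[of 0 x] by (simp add: f_def)
  moreover have "q (- z) \<le> - p z"
    using lower[of 1 "- z"] sublinear_0[OF p] by (simp add: f_def)
  ultimately show ?thesis by (auto simp: le_fun_def)
qed

lemma sublinear_dominates_minimal:
  assumes p: "sublinear p"
  shows "\<exists>q. sublinear q \<and> q \<le> p \<and> (\<forall>r. sublinear r \<longrightarrow> r \<le> q \<longrightarrow> r = q)"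
proof -
  define A where "A = {q. sublinear q \<and> q \<le> p}"
  define P where "P = (\<lambda>f g :: 'a \<Rightarrow> real. g \<le> f)"
  have "\<exists>m\<in>A. \<forall>a\<in>A. P m a \<longrightarrow> a = m"
  proof (rule predicate_Zorn)
    show "partial_order_on A (relation_of P A)"
      by (auto simp: partial_order_on_def preorder_on_def refl_on_def trans_def antisym_def
          relation_of_def P_def intro: order.trans)
  next
    fix C assume C: "C \<in> Chains (relation_of P A)"
    then have CA: "C \<subseteq> A" and tot: "\<And>f g. f \<in> C \<Longrightarrow> g \<in> C \<Longrightarrow> f \<le> g \<or> g \<le> f"
      by (auto simp: Chains_def relation_of_def P_def)
    show "\<exists>u\<in>A. \<forall>a\<in>C. P a u"
    proof (cases "C = {}")
      case True
      then show ?thesis using p by (auto simp: A_def)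
    next
      case False
      define u where "u x = (INF f\<in>C. f x)" for x
      have "- p (- x) \<le> f x" if "f \<in> C" for f x
      proof -
        have "sublinear f" "f (- x) \<le> p (- x)"
          using that CA by (auto simp: A_def le_fun_def)
        with sublinear_minus_ge[of f x] show ?thesis by linarith
      qed
      then have bdd: "bdd_below ((\<lambda>f. f x) ` C)" for x
        by (intro bdd_belowI[of _ "- p (- x)"]) auto
      have lower: "u \<le> f" if "f \<in> C" for f
        unfolding u_def le_fun_def using that by (auto intro!: cINF_lower[OF bdd])
      have "sublinear u"
        unfolding u_def
      proof (rule sublinear_INF[OF False bdd])
        fix f g assume fg: "f \<in> C" "g \<in> C"
        then have sub: "sublinear f" "sublinear g" using CA by (auto simp: A_def)
        from tot[OF fg] show "\<exists>h\<in>C. \<forall>x y. h (x + y) \<le> f x + g y"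
        proof
          assume le: "f \<le> g"
          have "f (x + y) \<le> f x + g y" for x y
            using sublinear_add[OF sub(1), of x y] le_funD[OF le, of y] by linarith
          with fg show ?thesis by blast
        next
          assume le: "g \<le> f"
          have "g (x + y) \<le> f x + g y" for x y
            using sublinear_add[OF sub(2), of x y] le_funD[OF le, of x] by linarith
          with fg show ?thesis by blast
        qed
      next
        fix f and t :: real assume "f \<in> C" "t > 0"
        then show "\<exists>h\<in>C. \<forall>x. h (t *\<^sub>R x) \<le> t * f x"
          using CA by (intro bexI[of _ f]) (auto simp: A_def sublinear_def)
      qed
      moreover have "u \<le> p"
      proof -
        obtain f where "f \<in> C" "f \<le> p" using False CA by (auto simp: A_def)
        with lower[of f] show ?thesis by (meson order.trans)
      qed
      ultimately show ?thesis
        using lower by (auto simp: A_def P_def)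
    qed
  qed
  then obtain m where "m \<in> A" "\<And>a. a \<in> A \<Longrightarrow> a \<le> m \<Longrightarrow> a = m"
    by (auto simp: P_def)
  then show ?thesis
    by (intro exI[of _ m]) (auto simp: A_def intro: order.trans)
qed

text \<open>Lowering a minimal sublinear functional in the direction \<open>z\<close> does not change it, so it is odd,
  and an odd sublinear functional is linear. Starting from \<open>p\<close> already lowered in the
  direction \<open>z\<close> forces the value \<open>p z\<close> at \<open>z\<close>.\<close>

theorem Hahn_Banach_sublinear:
  assumes p: "sublinear p"
  shows "\<exists>u. linear u \<and> (\<forall>x. u x \<le> p x) \<and> u z = p z"
proof -
  obtain p' where p': "sublinear p'" "p' \<le> p" "p' (- z) \<le> - p z"
    using sublinear_lower_in_direction[OF p] by blast
  obtain u where u: "sublinear u" "u \<le> p'" and min: "\<And>r. sublinear r \<Longrightarrow> r \<le> u \<Longrightarrow> r = u"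
    using sublinear_dominates_minimal[OF p'(1)] by blast
  have odd: "u (- x) = - u x" for x
  proof -
    obtain r where "sublinear r" "r \<le> u" "r (- x) \<le> - u x"
      using sublinear_lower_in_direction[OF u(1)] by blast
    with min have "u (- x) \<le> - u x" by blast
    with sublinear_minus_ge[OF u(1), of x] show ?thesis by linarith
  qed
  have "linear u"
  proof (rule linearI)
    fix x y
    show "u (x + y) = u x + u y"
      using sublinear_add[OF u(1), of x y] sublinear_add[OF u(1), of "x + y" "- y"] odd[of y]
      by simp
  next
    fix t :: real and x
    show "u (t *\<^sub>R x) = t *\<^sub>R u x"
    proof (cases "t \<ge> 0")
      case True
      then show ?thesis using sublinear_scaleR[OF u(1)] by simp
    next
      case False
      then show ?thesis using sublinear_scaleR[OF u(1), of "- t" x] odd[of "t *\<^sub>R x"] by simp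
    qed
  qed
  moreover have le: "u x \<le> p x" for x
    using le_funD[OF u(2), of x] le_funD[OF p'(2), of x] by linarith
  moreover have "u z = p z"
    using le[of z] le_funD[OF u(2), of "- z"] p'(3) odd[of z] by linarith
  ultimately show ?thesis by blast
qed

section \<open>Functionals on a complex normed space\<close>

lemma pairing_add_left: "\<langle>x + y, f\<rangle> = \<langle>x, f\<rangle> + \<langle>y, f\<rangle>"
  by transfer (rule blinfun.add_right)

lemma pairing_diff_left: "\<langle>x - y, f\<rangle> = \<langle>x, f\<rangle> - \<langle>y, f\<rangle>"
  by transfer (rule blinfun.diff_right)

lemma pairing_scaleC_left: "\<langle>c *\<^sub>C x, f\<rangle> = c * \<langle>x, f\<rangle>"
  by transfer blast

lemma pairing_scaleR_left: "\<langle>r *\<^sub>R x, f\<rangle> = r *\<^sub>R \<langle>x, f\<rangle>"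
  using pairing_scaleC_left[of "complex_of_real r" x f]
  by (simp add: scaleR_conv_of_real flip: scaleR_scaleC)

lemma pairing_0_left [simp]: "\<langle>0, f\<rangle> = 0"
  using pairing_diff_left[of 0 0 f] by simp

lemma pairing_add_right: "\<langle>x, f + g\<rangle> = \<langle>x, f\<rangle> + \<langle>x, g\<rangle>"
  by transfer (simp add: plus_blinfun.rep_eq)

lemma pairing_diff_right: "\<langle>x, f - g\<rangle> = \<langle>x, f\<rangle> - \<langle>x, g\<rangle>"
  by transfer (simp add: minus_blinfun.rep_eq)

lemma pairing_scaleC_right: "\<langle>x, c *\<^sub>C f\<rangle> = c * \<langle>x, f\<rangle>"
  by transfer simp

lemma norm_pairing_le: "cmod \<langle>x, f\<rangle> \<le> norm x * norm f"
  by transfer (metis mult.commute norm_blinfun)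

lemma Re_pairing_le: "Re \<langle>x, f\<rangle> \<le> norm x * norm f"
  using complex_Re_le_cmod norm_pairing_le by (rule order.trans)

text \<open>Rotating \<open>x\<close> turns a bound on real parts into a bound on moduli.\<close>

lemma cmod_le_of_Re_le:
  fixes \<phi> :: "'a::complex_normed_vector \<Rightarrow> complex"
  assumes scale: "\<And>c x. \<phi> (c *\<^sub>C x) = c * \<phi> x"
    and le: "\<And>x. Re (\<phi> x) \<le> K * norm x"
  shows "cmod (\<phi> x) \<le> K * norm x"
proof (cases "\<phi> x = 0")
  case True
  then show ?thesis using le[of x] by simp
next
  case False
  define c where "c = cnj (sgn (\<phi> x))"
  have "c * \<phi> x = complex_of_real (cmod (\<phi> x))"
    using False complex_norm_square[of "\<phi> x"]
    by (simp add: c_def sgn_eq power2_eq_square field_simps)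
  moreover have "cmod c = 1"
    using False by (simp add: c_def norm_sgn)
  ultimately show ?thesis
    using le[of "c *\<^sub>C x"] by (simp add: scale norm_scaleC)
qed

lemma norm_cdual_le_of_cmod:
  assumes "K \<ge> 0" "\<And>x. cmod \<langle>x, f\<rangle> \<le> K * norm x"
  shows "norm f \<le> K"
  using assms by transfer (auto intro: norm_blinfun_bound)

lemma norm_cdual_le:
  assumes "K \<ge> 0" "\<And>x. Re \<langle>x, f\<rangle> \<le> K * norm x"
  shows "norm f \<le> K"
  using assms(1) cmod_le_of_Re_le[of "\<lambda>x. \<langle>x, f\<rangle>" K] assms(2)
  by (intro norm_cdual_le_of_cmod) (auto simp: pairing_scaleC_left)

lemma obtain_cdual:
  fixes \<phi> :: "'a::complex_normed_vector \<Rightarrow> complex"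
  assumes add: "\<And>x y. \<phi> (x + y) = \<phi> x + \<phi> y"
    and scale: "\<And>c x. \<phi> (c *\<^sub>C x) = c * \<phi> x"
    and le: "\<And>x. Re (\<phi> x) \<le> K * norm x" and K: "K \<ge> 0"
  obtains f where "\<And>x. \<langle>x, f\<rangle> = \<phi> x" "norm f \<le> K"
proof -
  have "bounded_linear \<phi>"
  proof (rule bounded_linear_intro)
    show "\<phi> (r *\<^sub>R x) = r *\<^sub>R \<phi> x" for r x
      using scale[of "complex_of_real r" x] by (simp add: scaleR_conv_of_real flip: scaleR_scaleC)
    show "cmod (\<phi> x) \<le> norm x * K" for x
      using cmod_le_of_Re_le[of \<phi> K x] scale le by (simp add: mult.commute)
  qed (rule add)
  then have *: "\<langle>x, Abs_cdual (Blinfun \<phi>)\<rangle> = \<phi> x" for x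
    using scale by (simp add: pairing.rep_eq Abs_cdual_inverse bounded_linear_Blinfun_apply)
  then have "norm (Abs_cdual (Blinfun \<phi>)) \<le> K"
    using K le by (intro norm_cdual_le) auto
  with * show thesis by (rule that)
qed

text \<open>The complex functional with real part \<open>u\<close> is \<open>x \<mapsto> u x - \<i> u (\<i> x)\<close>.\<close>

theorem Hahn_Banach_norming_functional:
  fixes z :: "'a::complex_normed_vector"
  obtains f where "norm f \<le> 1" "\<langle>z, f\<rangle> = complex_of_real (norm z)"
proof -
  have "sublinear (norm :: 'a \<Rightarrow> real)"
    by (auto simp: sublinear_def norm_triangle_ineq)
  then obtain u :: "'a \<Rightarrow> real"
    where u: "linear u" "\<And>x. u x \<le> norm x" "u z = norm z"
    using Hahn_Banach_sublinear by blast
  define \<phi> where "\<phi> x = Complex (u x) (- u (\<i> *\<^sub>C x))" for x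
  have uC: "u (c *\<^sub>C x) = Re c * u x + Im c * u (\<i> *\<^sub>C x)" for c x
  proof -
    have "c = complex_of_real (Re c) + complex_of_real (Im c) * \<i>"
      using complex_eq[of c] by (simp add: mult.commute)
    then have "c *\<^sub>C x = Re c *\<^sub>R x + Im c *\<^sub>R (\<i> *\<^sub>C x)"
      by (metis scaleC_add_left scaleC_scaleC scaleR_scaleC)
    then show ?thesis
      using u(1) by (simp add: linear_add linear_scale)
  qed
  obtain f where f: "\<And>x. \<langle>x, f\<rangle> = \<phi> x" "norm f \<le> 1"
  proof (rule obtain_cdual)
    show "\<phi> (x + y) = \<phi> x + \<phi> y" for x y
      using u(1) by (simp add: \<phi>_def complex_eq_iff scaleC_add_right linear_add)
    show "\<phi> (c *\<^sub>C x) = c * \<phi> x" for c x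
      using uC[of c x] uC[of "\<i> * c" x]
      by (simp add: \<phi>_def complex_eq_iff scaleC_scaleC)
    show "Re (\<phi> x) \<le> 1 * norm x" for x
      using u(2) by (simp add: \<phi>_def)
  qed auto
  have re: "Re \<langle>z, f\<rangle> = norm z"
    using f u(3) by (simp add: \<phi>_def)
  have "cmod \<langle>z, f\<rangle> \<le> norm z * 1"
    using norm_pairing_le[of z f] f(2) mult_left_mono[OF f(2), of "norm z"] by simp
  then have "(cmod \<langle>z, f\<rangle>)\<^sup>2 \<le> (norm z)\<^sup>2"
    by (intro power_mono) simp_all
  then have "\<langle>z, f\<rangle> = complex_of_real (norm z)"
    using re by (simp add: cmod_power2 complex_eq_iff)
  with f(2) show thesis by (intro that)
qed

text \<open>If all real parts on the unit sphere were smaller, homogeneity and rotation would bound the norm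
  of \<open>f\<close> by \<open>norm f - e\<close>. A nonzero functional \<open>a\<close> witnesses that there are unit vectors at all; the
  zero space has none.\<close>

lemma almost_norming_unit_vector:
  fixes a f :: "'a::complex_normed_vector cdual"
  assumes a: "a \<noteq> 0" and e: "e > 0"
  obtains x where "norm x = 1" "norm f - e \<le> Re \<langle>x, f\<rangle>"
proof (rule ccontr)
  assume no: "\<not> thesis"
  note found = that
  have less: "Re \<langle>x, f\<rangle> < norm f - e" if "norm x = 1" for x
  proof (rule ccontr)
    assume "\<not> Re \<langle>x, f\<rangle> < norm f - e"
    then have thesis using found[OF \<open>norm x = 1\<close>] by simp
    with no show False ..
  qed
  have bound: "Re \<langle>x, f\<rangle> \<le> (norm f - e) * norm x" for x
  proof (cases "x = 0")
    case True
    then show ?thesis by simp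
  next
    case False
    then show ?thesis
      using less[of "x /\<^sub>R norm x"] by (simp add: pairing_scaleR_left divide_simps mult.commute)
  qed
  have "\<exists>x::'a. x \<noteq> 0"
  proof (rule ccontr)
    assume triv: "\<nexists>x::'a. x \<noteq> 0"
    have "norm a \<le> 0"
    proof (rule norm_cdual_le)
      fix x :: 'a
      have "x = 0" using triv by blast
      then show "Re \<langle>x, a\<rangle> \<le> 0 * norm x" by simp
    qed simp
    with a show False by simp
  qed
  then obtain x :: 'a where x: "x \<noteq> 0" by blast
  have "0 \<le> (norm f - e) * norm x"
    using bound[of x] bound[of "- x"] pairing_diff_left[of 0 x f] by simp
  then have "norm f - e \<ge> 0"
    using x by (simp add: zero_le_mult_iff)
  from norm_cdual_le[OF this bound] e show False by simp
qed

text \<open>That the embedding into the bidual does not decrease norms is the Hahn-Banach theorem.\<close>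

lemma bidual_embedding:
  obtains J :: "'a::complex_normed_vector \<Rightarrow> 'a cdual cdual"
  where "\<And>x f. \<langle>f, J x\<rangle> = \<langle>x, f\<rangle>" "\<And>x. norm (J x) \<le> norm x"
    "\<And>x y. norm (x - y) \<le> norm (J x - J y)"
proof -
  have "\<exists>g. (\<forall>f. \<langle>f, g\<rangle> = \<langle>x, f\<rangle>) \<and> norm g \<le> norm x" for x :: 'a
    by (rule obtain_cdual[of "\<lambda>f. \<langle>x, f\<rangle>" "norm x"])
       (auto simp: pairing_add_right pairing_scaleC_right Re_pairing_le)
  then obtain J :: "'a \<Rightarrow> 'a cdual cdual"
    where J: "\<And>x f. \<langle>f, J x\<rangle> = \<langle>x, f\<rangle>" "\<And>x. norm (J x) \<le> norm x"
    by metis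
  have "norm (x - y) \<le> norm (J x - J y)" for x y
  proof -
    obtain f where f: "norm f \<le> 1" "\<langle>x - y, f\<rangle> = complex_of_real (norm (x - y))"
      by (rule Hahn_Banach_norming_functional)
    have "norm (x - y) = Re \<langle>f, J x - J y\<rangle>"
      using f(2) by (simp add: pairing_diff_left pairing_diff_right J(1))
    also have "\<dots> \<le> norm f * norm (J x - J y)"
      by (rule Re_pairing_le)
    also have "\<dots> \<le> norm (J x - J y)"
      using mult_right_mono[OF f(1), of "norm (J x - J y)"] by simp
    finally show ?thesis .
  qed
  with J show thesis by (rule that)
qed

section \<open>Frechet differentiability and slices of the dual ball\<close>

lemma frechet_differentiable_slice:
  fixes a :: "'a::complex_banach"
  assumes "frechet_differentiable_space TYPE('a)" and a: "norm a = 1" and e: "e > 0"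
  obtains d where "d > 0"
    "\<And>f g. norm f \<le> 1 \<Longrightarrow> norm g \<le> 1 \<Longrightarrow> Re \<langle>a, f\<rangle> > 1 - d \<Longrightarrow> Re \<langle>a, g\<rangle> > 1 - d \<Longrightarrow>
      norm (f - g) \<le> e"
proof -
  let ?q = "\<lambda>h. (norm (a + h) + norm (a - h) - 2 * norm a) / norm h"
  have "a \<noteq> 0" using a by auto
  then have "(?q \<longlongrightarrow> 0) (at 0)"
    using assms(1) by (simp add: frechet_differentiable_space_def)
  then have "\<forall>\<^sub>F h in at 0. dist (?q h) 0 < e / 2"
    using e by (intro tendstoD) auto
  then obtain s where s: "s > 0" "\<And>h. h \<noteq> 0 \<Longrightarrow> norm h < s \<Longrightarrow> \<bar>?q h\<bar> < e / 2"
    by (auto simp: eventually_at)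
  define t where "t = s / 2"
  have t: "t > 0" "t < s" using s(1) by (auto simp: t_def)
  show thesis
  proof (rule that)
    \<comment> \<open>With this threshold, the second difference (at most \<open>e t / 2\<close>) and the two slice errors
      add up to \<open>e t\<close>.\<close>
    show "t * e / 4 > 0" using t e by simp
    fix f g assume fg: "norm f \<le> 1" "norm g \<le> 1"
      "Re \<langle>a, f\<rangle> > 1 - t * e / 4" "Re \<langle>a, g\<rangle> > 1 - t * e / 4"
    have small: "Re \<langle>h, f - g\<rangle> \<le> e * t" if h: "norm h = t" for h
    proof -
      have "Re \<langle>a + h, f\<rangle> \<le> norm (a + h)" "Re \<langle>a - h, g\<rangle> \<le> norm (a - h)"
        using Re_pairing_le[of "a + h" f] mult_left_mono[OF fg(1), of "norm (a + h)"]
          Re_pairing_le[of "a - h" g] mult_left_mono[OF fg(2), of "norm (a - h)"] by simp_all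
      moreover have "norm (a + h) + norm (a - h) - 2 < e / 2 * t"
      proof -
        have "h \<noteq> 0" using h t by auto
        then have "?q h < e / 2" using s(2)[of h] h t by linarith
        with h t a show ?thesis by (simp add: pos_divide_less_eq)
      qed
      ultimately show ?thesis
        using fg(3,4)
        by (simp add: pairing_add_left pairing_diff_left pairing_diff_right algebra_simps)
    qed
    show "norm (f - g) \<le> e"
    proof (rule norm_cdual_le)
      fix x
      show "Re \<langle>x, f - g\<rangle> \<le> e * norm x"
      proof (cases "x = 0")
        case True
        then show ?thesis by simp
      next
        case False
        then have "t / norm x * Re \<langle>x, f - g\<rangle> \<le> e * t"
          using small[of "(t / norm x) *\<^sub>R x"] t by (simp add: pairing_scaleR_left)
        with False t show ?thesis by (simp add: field_simps)
      qed
    qed (use e in simp)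
  qed
qed

text \<open>The unique point is a functional norming \<open>y\<close>. It lies in every slice at \<open>y\<close>, which gives
  both the convergence of the slices to it and its uniqueness.\<close>

theorem frechet_differentiable_imp_uniformly_smooth:
  assumes F: "frechet_differentiable_space TYPE('a::complex_banach)"
  shows "uniformly_smooth_space TYPE('a)"
  unfolding uniformly_smooth_space_def
proof (intro allI impI)
  fix y :: 'a assume "y \<in> sphere 0 1"
  then have y: "norm y = 1" by simp
  obtain n where n: "norm n \<le> 1" "\<langle>y, n\<rangle> = 1"
    using Hahn_Banach_norming_functional[of y] y by auto
  have n1: "norm n = 1"
    using norm_pairing_le[of y n] n y by simp
  let ?P = "\<lambda>y'. y' \<in> sphere 0 1 \<and>
        (\<forall>\<epsilon>>0. \<exists>\<delta>>0. \<forall>g\<in>cball 0 1.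
          \<langle>y, g\<rangle> \<in> \<real> \<and> Re \<langle>y, g\<rangle> > 1 - \<delta> \<longrightarrow> norm (y' - g) < \<epsilon>)"
  show "\<exists>!y'. ?P y'"
  proof (rule ex1I[of _ n])
    have "\<exists>\<delta>>0. \<forall>g\<in>cball 0 1. \<langle>y, g\<rangle> \<in> \<real> \<and> Re \<langle>y, g\<rangle> > 1 - \<delta> \<longrightarrow> norm (n - g) < \<epsilon>"
      if "\<epsilon> > 0" for \<epsilon> :: real
    proof -
      have "\<epsilon> / 2 > 0" using that by simp
      then obtain d where d: "d > 0" "\<And>f g. norm f \<le> 1 \<Longrightarrow> norm g \<le> 1 \<Longrightarrow>
          Re \<langle>y, f\<rangle> > 1 - d \<Longrightarrow> Re \<langle>y, g\<rangle> > 1 - d \<Longrightarrow> norm (f - g) \<le> \<epsilon> / 2"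
        using frechet_differentiable_slice[OF F y] by blast
      have "norm (n - g) < \<epsilon>" if "norm g \<le> 1" "Re \<langle>y, g\<rangle> > 1 - d" for g
        using d(2)[of n g] d(1) n that \<open>\<epsilon> > 0\<close> by simp
      with d(1) show ?thesis by (intro exI[of _ d]) auto
    qed
    with n1 show "?P n" by simp
  next
    fix y' assume P: "?P y'"
    have "norm (y' - n) < \<epsilon>" if "\<epsilon> > 0" for \<epsilon>
    proof -
      obtain d where "d > 0" "\<forall>g\<in>cball 0 1. \<langle>y, g\<rangle> \<in> \<real> \<and> Re \<langle>y, g\<rangle> > 1 - d \<longrightarrow> norm (y' - g) < \<epsilon>"
        using P \<open>\<epsilon> > 0\<close> by blast
      then show ?thesis using n by auto
    qed
    from this[of "norm (y' - n)"] show "y' = n" by force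
  qed
qed

section \<open>Norming sequences in a predual\<close>

text \<open>The definition of uniform smoothness sees only functionals with a real value at \<open>a\<close>, so
  \<open>x n\<close> is first multiplied by the unimodular number that makes \<open>\<langle>x n, a\<rangle>\<close> positive; these numbers
  tend to \<open>1\<close>, so in the limit the rotation does not matter.\<close>

lemma uniformly_smooth_dual_norming_sequence:
  fixes x :: "nat \<Rightarrow> 'a::complex_banach" and J :: "'a \<Rightarrow> 'a cdual cdual"
  assumes J: "\<And>x f. \<langle>f, J x\<rangle> = \<langle>x, f\<rangle>" "\<And>x. norm (J x) \<le> norm x"
    and x: "\<And>n. norm (x n) = 1" and lim: "(\<lambda>n. \<langle>x n, a\<rangle>) \<longlonglongrightarrow> 1"
    and z: "\<And>\<epsilon>. \<epsilon> > 0 \<Longrightarrow> \<exists>\<delta>>0. \<forall>g\<in>cball 0 1.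
        \<langle>a, g\<rangle> \<in> \<real> \<and> Re \<langle>a, g\<rangle> > 1 - \<delta> \<longrightarrow> norm (z - g) < \<epsilon>"
  shows "(\<lambda>n. J (x n)) \<longlonglongrightarrow> z"
proof -
  \<comment> \<open>Since \<open>sgn 0 = 0\<close>, some \<open>u n\<close> may vanish instead of being unimodular, but only finitely many.\<close>
  define u where "u n = cnj (sgn \<langle>x n, a\<rangle>)" for n
  have "(\<lambda>n. cnj (sgn \<langle>x n, a\<rangle>)) \<longlonglongrightarrow> cnj (sgn 1)"
    using lim by (intro tendsto_intros) auto
  then have u1: "u \<longlonglongrightarrow> 1" by (simp add: u_def[abs_def])
  have rot: "\<langle>u n *\<^sub>C x n, a\<rangle> = complex_of_real (cmod \<langle>x n, a\<rangle>)" for n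
    using complex_norm_square[of "\<langle>x n, a\<rangle>"]
    by (cases "\<langle>x n, a\<rangle> = 0")
       (simp_all add: pairing_scaleC_left u_def sgn_eq power2_eq_square field_simps)
  have "norm (J (u n *\<^sub>C x n)) \<le> 1" for n
  proof -
    have "cmod (u n) \<le> 1" by (simp add: u_def norm_sgn)
    with J(2)[of "u n *\<^sub>C x n"] x show ?thesis by (simp add: norm_scaleC)
  qed
  moreover have "(\<lambda>n. cmod \<langle>x n, a\<rangle>) \<longlonglongrightarrow> 1"
    using tendsto_norm[OF lim] by simp
  ultimately have "\<forall>\<^sub>F n in sequentially. norm (J (u n *\<^sub>C x n) - z) < \<epsilon>" if "\<epsilon> > 0" for \<epsilon>
  proof -
    obtain d where d: "d > 0" "\<forall>g\<in>cball 0 1.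
        \<langle>a, g\<rangle> \<in> \<real> \<and> Re \<langle>a, g\<rangle> > 1 - d \<longrightarrow> norm (z - g) < \<epsilon>"
      using z[OF \<open>\<epsilon> > 0\<close>] by blast
    have "\<forall>\<^sub>F n in sequentially. 1 - d < cmod \<langle>x n, a\<rangle>"
      using order_tendstoD(1)[OF \<open>(\<lambda>n. cmod \<langle>x n, a\<rangle>) \<longlonglongrightarrow> 1\<close>, of "1 - d"] d(1) by simp
    then show ?thesis
    proof (rule eventually_mono)
      fix n assume "1 - d < cmod \<langle>x n, a\<rangle>"
      with d(2) \<open>norm (J (u n *\<^sub>C x n)) \<le> 1\<close> have "norm (z - J (u n *\<^sub>C x n)) < \<epsilon>"
        by (simp add: J(1) rot)
      then show "norm (J (u n *\<^sub>C x n) - z) < \<epsilon>"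
        by (simp add: norm_minus_commute)
    qed
  qed
  then have "(\<lambda>n. J (u n *\<^sub>C x n)) \<longlonglongrightarrow> z"
    by (auto simp: tendsto_iff dist_norm)
  moreover have "(\<lambda>n. J (x n) - J (u n *\<^sub>C x n)) \<longlonglongrightarrow> 0"
  proof (rule Lim_null_comparison)
    have "norm (J (x n) - J (u n *\<^sub>C x n)) \<le> cmod (1 - u n)" for n
    proof (rule norm_cdual_le)
      fix f :: "'a cdual"
      have "Re \<langle>f, J (x n) - J (u n *\<^sub>C x n)\<rangle> = Re \<langle>(1 - u n) *\<^sub>C x n, f\<rangle>"
        by (simp add: pairing_diff_right J(1) pairing_scaleC_left algebra_simps)
      also have "\<dots> \<le> cmod (1 - u n) * norm f"
        using Re_pairing_le[of "(1 - u n) *\<^sub>C x n" f] x by (simp add: norm_scaleC)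
      finally show "Re \<langle>f, J (x n) - J (u n *\<^sub>C x n)\<rangle> \<le> cmod (1 - u n) * norm f" .
    qed simp
    then show "\<forall>\<^sub>F n in sequentially. norm (J (x n) - J (u n *\<^sub>C x n)) \<le> cmod (1 - u n)"
      by simp
    show "(\<lambda>n. cmod (1 - u n)) \<longlonglongrightarrow> 0"
      using tendsto_norm[OF tendsto_diff[OF tendsto_const[of 1] u1]] by simp
  qed
  ultimately show ?thesis
    using tendsto_add by fastforce
qed

theorem uniformly_smooth_dual_imp_norming_sequences_close:
  fixes x y :: "nat \<Rightarrow> 'a::complex_banach"
  assumes U: "uniformly_smooth_space TYPE('a cdual)"
    and x: "\<And>n. norm (x n) = 1" and y: "\<And>n. norm (y n) = 1" and a: "norm a = 1"
    and xa: "(\<lambda>n. \<langle>x n, a\<rangle>) \<longlonglongrightarrow> 1" and ya: "(\<lambda>n. \<langle>y n, a\<rangle>) \<longlonglongrightarrow> 1"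
  shows "(\<lambda>n. norm (x n - y n)) \<longlonglongrightarrow> 0"
proof -
  obtain J :: "'a \<Rightarrow> 'a cdual cdual" where J: "\<And>x f. \<langle>f, J x\<rangle> = \<langle>x, f\<rangle>"
    "\<And>x. norm (J x) \<le> norm x" "\<And>x y. norm (x - y) \<le> norm (J x - J y)"
    by (rule bidual_embedding) blast
  have "a \<in> sphere 0 1" using a by simp
  then obtain z where z: "\<And>\<epsilon>. \<epsilon> > 0 \<Longrightarrow> \<exists>\<delta>>0. \<forall>g\<in>cball 0 1.
        \<langle>a, g\<rangle> \<in> \<real> \<and> Re \<langle>a, g\<rangle> > 1 - \<delta> \<longrightarrow> norm (z - g) < \<epsilon>"
    using U unfolding uniformly_smooth_space_def by blast
  have "(\<lambda>n. J (x n) - J (y n)) \<longlonglongrightarrow> z - z"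
    by (intro tendsto_diff uniformly_smooth_dual_norming_sequence[OF J(1,2) x xa z]
        uniformly_smooth_dual_norming_sequence[OF J(1,2) y ya z])
  then have "(\<lambda>n. norm (J (x n) - J (y n))) \<longlonglongrightarrow> 0"
    by (simp add: tendsto_norm_zero_iff)
  then show ?thesis
    by (rule tendsto_sandwich[OF _ _ tendsto_const, rotated 2]) (simp_all add: J(3))
qed

text \<open>In the unit disc, \<open>\<bar>z - 1\<bar>\<^sup>2 \<le> 2 (1 - Re z)\<close>.\<close>

lemma tendsto_1_of_Re:
  assumes le: "\<And>n. cmod (z n) \<le> 1" and lim: "(\<lambda>n. Re (z n)) \<longlonglongrightarrow> 1"
  shows "z \<longlonglongrightarrow> 1"
proof -
  have bound: "(cmod (z n - 1))\<^sup>2 \<le> 2 - 2 * Re (z n)" for n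
  proof -
    have "(Re (z n))\<^sup>2 + (Im (z n))\<^sup>2 \<le> 1"
      using power_mono[OF le[of n] norm_ge_zero, of 2] by (simp add: cmod_power2)
    then show ?thesis
      unfolding cmod_power2 by (simp add: power2_eq_square algebra_simps)
  qed
  have "(\<lambda>n. 2 - 2 * Re (z n)) \<longlonglongrightarrow> 2 - 2 * 1"
    using lim by (intro tendsto_intros)
  then have "(\<lambda>n. 2 - 2 * Re (z n)) \<longlonglongrightarrow> 0" by simp
  then have "(\<lambda>n. (cmod (z n - 1))\<^sup>2) \<longlonglongrightarrow> 0"
    by (rule tendsto_sandwich[OF _ _ tendsto_const, rotated 2]) (simp_all add: bound)
  then have "(\<lambda>n. sqrt ((cmod (z n - 1))\<^sup>2)) \<longlonglongrightarrow> sqrt 0"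
    by (rule tendsto_real_sqrt)
  then have "(\<lambda>n. z n - 1) \<longlonglongrightarrow> 0"
    by (simp add: tendsto_norm_zero_iff)
  then show ?thesis by (simp add: LIM_zero_iff)
qed

text \<open>Passing from \<open>a + k n\<close> to \<open>a\<close> changes the norm and the value at a unit vector by at most
  \<open>norm (k n)\<close> each, so \<open>Re \<langle>x n, a\<rangle>\<close> is squeezed towards \<open>norm a\<close>.\<close>

lemma almost_norming_perturbation:
  fixes a :: "'a::complex_normed_vector cdual"
  assumes a: "a \<noteq> 0" and x: "\<And>n. norm (x n) = 1" and k: "k \<longlonglongrightarrow> 0"
    and near: "\<And>n. norm (a + k n) - norm (k n) * norm (k n) \<le> Re \<langle>x n, a + k n\<rangle>"
  shows "(\<lambda>n. \<langle>x n, a /\<^sub>R norm a\<rangle>) \<longlonglongrightarrow> 1"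
proof (rule tendsto_1_of_Re)
  fix n
  show "cmod \<langle>x n, a /\<^sub>R norm a\<rangle> \<le> 1"
    using norm_pairing_le[of "x n" "a /\<^sub>R norm a"] x a by simp
next
  have pair: "Re \<langle>x n, a /\<^sub>R norm a\<rangle> = Re \<langle>x n, a\<rangle> / norm a" for n
    by (simp add: scaleR_scaleC pairing_scaleC_right divide_inverse mult.commute flip: of_real_inverse)
  have "(\<lambda>n. norm (a + k n) - norm (k n) * norm (k n) - norm (k n))
      \<longlonglongrightarrow> norm (a + 0) - norm (0::'a cdual) * norm (0::'a cdual) - norm (0::'a cdual)"
    using k by (intro tendsto_intros)
  then have "(\<lambda>n. norm (a + k n) - norm (k n) * norm (k n) - norm (k n)) \<longlonglongrightarrow> norm a"
    by simp
  then have "(\<lambda>n. Re \<langle>x n, a\<rangle>) \<longlonglongrightarrow> norm a"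
  proof (rule tendsto_sandwich[OF _ _ _ tendsto_const, rotated 2])
    show "\<forall>\<^sub>F n in sequentially. norm (a + k n) - norm (k n) * norm (k n) - norm (k n) \<le> Re \<langle>x n, a\<rangle>"
    proof (rule always_eventually, rule allI)
      fix n
      show "norm (a + k n) - norm (k n) * norm (k n) - norm (k n) \<le> Re \<langle>x n, a\<rangle>"
        using near[of n] Re_pairing_le[of "x n" "k n"] x[of n] by (simp add: pairing_add_right)
    qed
    show "\<forall>\<^sub>F n in sequentially. Re \<langle>x n, a\<rangle> \<le> norm a"
      using Re_pairing_le[of "x _" a] x by (auto intro!: always_eventually)
  qed
  from tendsto_divide[OF this tendsto_const[of "norm a"]] a
  show "(\<lambda>n. Re \<langle>x n, a /\<^sub>R norm a\<rangle>) \<longlonglongrightarrow> 1"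
    by (simp add: pair)
qed

text \<open>The error \<open>\<parallel>h\<parallel>\<^sup>2\<close> allowed for the almost norming vectors is \<open>o(\<parallel>h\<parallel>)\<close>, so it disappears
  from the difference quotient, which is then at most \<open>\<parallel>x n - y n\<parallel> + 2 \<parallel>h\<parallel>\<close>.\<close>

theorem norming_sequences_close_imp_frechet_differentiable:
  assumes close: "\<And>(x :: nat \<Rightarrow> 'a::complex_banach) y a.
      (\<And>n. norm (x n) = 1) \<Longrightarrow> (\<And>n. norm (y n) = 1) \<Longrightarrow> norm a = 1 \<Longrightarrow>
      (\<lambda>n. \<langle>x n, a\<rangle>) \<longlonglongrightarrow> 1 \<Longrightarrow> (\<lambda>n. \<langle>y n, a\<rangle>) \<longlonglongrightarrow> 1 \<Longrightarrow>
      (\<lambda>n. norm (x n - y n)) \<longlonglongrightarrow> 0"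
  shows "frechet_differentiable_space TYPE('a cdual)"
  unfolding frechet_differentiable_space_def tendsto_at_iff_sequentially
proof (intro allI impI)
  fix a :: "'a cdual" and h :: "nat \<Rightarrow> 'a cdual"
  assume a: "a \<noteq> 0" and "\<forall>i. h i \<in> UNIV - {0}" and h0: "h \<longlonglongrightarrow> 0"
  then have h: "h n \<noteq> 0" for n by auto
  have ex: "\<exists>x. \<forall>n. norm (x n) = 1 \<and>
      norm (a + k n) - norm (k n) * norm (k n) \<le> Re \<langle>x n, a + k n\<rangle>"
    if k: "\<And>n. k n \<noteq> 0" for k :: "nat \<Rightarrow> 'a cdual"
  proof (intro choice allI)
    fix n
    have "norm (k n) * norm (k n) > 0" using k[of n] by simp
    then show "\<exists>x. norm x = 1 \<and>
        norm (a + k n) - norm (k n) * norm (k n) \<le> Re \<langle>x, a + k n\<rangle>"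
      using almost_norming_unit_vector[OF a] by metis
  qed
  obtain x where x: "\<And>n. norm (x n) = 1"
    and nx: "\<And>n. norm (a + h n) - norm (h n) * norm (h n) \<le> Re \<langle>x n, a + h n\<rangle>"
    using ex[of h] h by blast
  obtain y where y: "\<And>n. norm (y n) = 1"
    and ny: "\<And>n. norm (a + - h n) - norm (- h n) * norm (- h n) \<le> Re \<langle>y n, a + - h n\<rangle>"
    using ex[of "\<lambda>n. - h n"] h by auto
  have "(\<lambda>n. - h n) \<longlonglongrightarrow> 0" using tendsto_minus[OF h0] by simp
  then have "(\<lambda>n. norm (x n - y n)) \<longlonglongrightarrow> 0"
    using a by (intro close[of x y "a /\<^sub>R norm a"] almost_norming_perturbation[OF a _ h0 nx]
        almost_norming_perturbation[OF a _ _ ny] x y) simp_all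
  then have "(\<lambda>n. norm (x n - y n) + 2 * norm (h n)) \<longlonglongrightarrow> 0 + 2 * norm (0::'a cdual)"
    using h0 by (intro tendsto_intros)
  then have upper: "(\<lambda>n. norm (x n - y n) + 2 * norm (h n)) \<longlonglongrightarrow> 0" by simp
  let ?q = "\<lambda>h. (norm (a + h) + norm (a - h) - 2 * norm a) / norm h"
  have "0 \<le> ?q (h n)" for n
  proof -
    have "norm (2 *\<^sub>R a) \<le> norm (a + h n) + norm (a - h n)"
      using norm_triangle_ineq[of "a + h n" "a - h n"] by (simp add: scaleR_2)
    then show ?thesis by simp
  qed
  moreover have "?q (h n) \<le> norm (x n - y n) + 2 * norm (h n)" for n
  proof -
    have "norm (a + h n) + norm (a - h n)
        \<le> Re \<langle>x n, a\<rangle> + Re \<langle>y n, a\<rangle> + Re \<langle>x n - y n, h n\<rangle> + 2 * (norm (h n) * norm (h n))"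
      using nx[of n] ny[of n]
      by (simp add: pairing_add_right pairing_diff_right pairing_diff_left)
    also have "\<dots> \<le> 2 * norm a + norm (x n - y n) * norm (h n) + 2 * (norm (h n) * norm (h n))"
      using Re_pairing_le[of "x n" a] Re_pairing_le[of "y n" a]
        Re_pairing_le[of "x n - y n" "h n"] x[of n] y[of n] by simp
    finally show ?thesis
      using h[of n] by (simp add: field_simps)
  qed
  ultimately show "(?q \<circ> h) \<longlonglongrightarrow> 0"
    unfolding o_def by (intro tendsto_sandwich[OF _ _ tendsto_const upper]) simp_all
qed

theorem corollary1p6:
  shows "(frechet_differentiable_space TYPE('a::complex_banach cdual) \<longleftrightarrow>
      (\<forall>(x :: nat \<Rightarrow> 'a) (y :: nat \<Rightarrow> 'a) (a :: 'a cdual).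
        (\<forall>n. x n \<in> sphere 0 1) \<longrightarrow> (\<forall>n. y n \<in> sphere 0 1) \<longrightarrow> a \<in> sphere 0 1 \<longrightarrow>
        (\<lambda>n. \<langle>x n, a\<rangle>) \<longlonglongrightarrow> 1 \<longrightarrow> (\<lambda>n. \<langle>y n, a\<rangle>) \<longlonglongrightarrow> 1 \<longrightarrow>
        (\<lambda>n. norm (x n - y n)) \<longlonglongrightarrow> 0)) \<and>
    (frechet_differentiable_space TYPE('a cdual) \<longleftrightarrow> uniformly_smooth_space TYPE('a cdual))"
    (is "(?F \<longleftrightarrow> ?S) \<and> (?F \<longleftrightarrow> ?U)")
proof -
  have "?F \<Longrightarrow> ?U"
    by (rule frechet_differentiable_imp_uniformly_smooth)
  moreover have "?U \<Longrightarrow> ?S"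
    using uniformly_smooth_dual_imp_norming_sequences_close[where ?'a = 'a] by simp
  moreover have "?S \<Longrightarrow> ?F"
    by (rule norming_sequences_close_imp_frechet_differentiable) simp
  ultimately show ?thesis by blast
qed

end
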